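(* Let $\alpha(a,r,t)$, $\beta(a,r,t)$ and $\gamma(a,r,t)$ be real functions defined on $(0,1/2]\times(0,1)\times(0,1)$. Then: (1) The inequality $$\frac{\varphi_K^a(r)\varphi_K^a(t)}{\varphi_K^a(rt)}<e^{\alpha(a,r,t)\left(1-\frac1K\right)}$$ holds for all $(a,r,t)\in(0,1/2]\times(0,1)\times(0,1)$ and $K\in(1,\infty)$ if and only if $\alpha(a,r,t)\ge m_a(r)+m_a(t)-m_a(rt)$ for all $(a,r,t)\in(0,1/2]\times(0,1)\times(0,1)$. (2) The double inequality $$e^{\gamma(a,r,t)(1-K)}<\frac{\varphi_{1/K}^a(r)\varphi_{1/K}^a(t)}{\varphi_{1/K}^a(rt)}<e^{\beta(a,r,t)(1-K)}$$ holds for all $(a,r,t)\in(0,1/2]\times(0,1)\times(0,1)$ and $K\in(1,\infty)$ if and only if $\beta(a,r,t)\le m_a(r)+m_a(t)-m_a(rt)$ and $\gamma(a,r,t)\ge \mu_a(r)+\mu_a(t)-\mu_a(rt)$ for all $(a,r,t)\in(0,1/2]\times(0,1)\times(0,1)$.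
   Context: $F(\alpha,\beta;c;x)=\sum_{n=0}^\infty\frac{(\alpha)_n(\beta)_n}{(c)_n}\frac{x^n}{n!}$, $|x|<1$, is the Gaussian hypergeometric function, with $(x)_0=1$, $(x)_n=x(x+1)\cdots(x+n-1)$. For $a\in(0,1/2]$ and $r\in(0,1)$: the generalized Grötzsch ring function is $\mu_a(r)=\frac{\pi}{2\sin(\pi a)}\frac{F(a,1-a;1;1-r^2)}{F(a,1-a;1;r^2)}$, a strictly decreasing homeomorphism from $(0,1)$ onto $(0,\infty)$; the generalized Hübner function $m_a(r)$ is defined with the generalized elliptic integral $\mathscr{K}_a(r)=\frac{\pi}{2}F(a,1-a;1;r^2)$ by $m_a(r)=\frac{2}{\pi\sin(\pi a)}(1-r^2)\,\mathscr{K}_a(r)\,\mathscr{K}_a(\sqrt{1-r^2})$; for $K\in(0,\infty)$ the generalized Hersch–Pfluger distortion function is $\varphi_K^a(r)=\mu_a^{-1}(\mu_a(r)/K)$. *)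

theory Defs
  imports "HOL-Analysis.Analysis"
begin

definition hyp2F1 :: "real \<Rightarrow> real \<Rightarrow> real \<Rightarrow> real \<Rightarrow> real" where
  "hyp2F1 \<alpha> \<beta> c x =
     (\<Sum>n. pochhammer \<alpha> n * pochhammer \<beta> n / pochhammer c n * (x ^ n / fact n))"

definition ell_K :: "real \<Rightarrow> real \<Rightarrow> real" where
  "ell_K a r = pi / 2 * hyp2F1 a (1 - a) 1 (r\<^sup>2)"

definition mu :: "real \<Rightarrow> real \<Rightarrow> real" where
  "mu a r = pi / (2 * sin (pi * a)) *
     (hyp2F1 a (1 - a) 1 (1 - r\<^sup>2) / hyp2F1 a (1 - a) 1 (r\<^sup>2))"

definition huebner_m :: "real \<Rightarrow> real \<Rightarrow> real" where
  "huebner_m a r =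
     2 / (pi * sin (pi * a)) * (1 - r\<^sup>2) * ell_K a r * ell_K a (sqrt (1 - r\<^sup>2))"

text \<open>The inverse of the bijection \<^term>\<open>mu a\<close> from \<open>(0,1)\<close> onto \<open>(0,\<infinity>)\<close>; its values
  are meaningful only for \<open>0 < a \<le> 1/2\<close> and at positive arguments.\<close>

definition mu_inv :: "real \<Rightarrow> real \<Rightarrow> real" where
  "mu_inv a = the_inv_into {0<..<1} (mu a)"

definition phi :: "real \<Rightarrow> real \<Rightarrow> real \<Rightarrow> real" where
  "phi a K r = mu_inv a (mu a r / K)"

end

theory Submission
  imports Defs
begin

text \<open>
  Write \<open>F(x) = F(a, 1 - a; 1; x)\<close> and parametrise \<open>r \<in> (0,1)\<close> by \<open>u = \<mu>\<^sub>a(r)\<close>. Put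
  \<open>y(u) = - ln r\<close>. The Wronskian (Legendre) relation for \<open>F(x)\<close> and \<open>F(1 - x)\<close> gives
  \<open>y' = G\<close> with \<open>G(u) = (1 - r\<^sup>2) F(r\<^sup>2)\<^sup>2\<close>, and \<open>u G(u) = m\<^sub>a(r)\<close>. Replacing \<open>K\<close> by the
  scaling factor \<open>k\<close> of \<open>u\<close> (\<open>k = 1/K\<close> in the first part, \<open>k = K\<close> in the second), the
  logarithm of the quotient to be estimated is \<open>- \<Delta>(k)\<close>, where
  \<open>\<Delta>(k) = y(kp) + y(kq) - y(ks)\<close> with \<open>p = \<mu>\<^sub>a(r)\<close>, \<open>q = \<mu>\<^sub>a(t)\<close>, \<open>s = \<mu>\<^sub>a(rt)\<close>.
  Here \<open>\<Delta>(1) = 0\<close>, the slope \<open>\<Delta>'(1)\<close> is \<open>m\<^sub>a(r) + m\<^sub>a(t) - m\<^sub>a(rt)\<close>, and \<open>\<Delta>'(k)\<close> tends to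
  \<open>p + q - s\<close> as \<open>k\<close> grows, because \<open>G\<close> tends to 1. So both parts state that the best
  constants in linear bounds of \<open>\<Delta>\<close> through the point \<open>k = 1\<close> are the slope at 1 and the slope
  at infinity.

  In general \<open>\<Delta>\<close> is not convex on all of \<open>(0,\<infinity>)\<close>, but it is enough that
  \<open>\<Delta>'(k) < \<Delta>'(n)\<close> whenever \<open>k < n\<close> and \<open>1 \<le> n\<close> (\<open>slope_strict_mono_above\<close>); the mean
  value theorem then gives all inequalities. Write
  \<open>\<Delta>'(k) = s G(ks) (\<rho>(k) - 1)\<close> with \<open>\<rho>(k) = (p G(kp) + q G(kq)) / (s G(ks))\<close>. The function
  \<open>G\<close> increases, and \<open>\<rho>\<close> increases as soon as the elasticity \<open>E = u G'/G\<close> decreases in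
  \<open>u\<close>, because \<open>p, q < s\<close>. Moreover \<open>\<rho>(1) > 1\<close>: otherwise \<open>\<Delta>\<close> would be strictly decreasing
  on \<open>(0,1]\<close>, although it vanishes both at 1 and in the limit at 0. Hence \<open>\<Delta>'\<close> is positive
  and increasing where \<open>\<rho> > 1\<close>, in particular from 1 onwards, and nonpositive elsewhere.

  It remains to see that \<open>E\<close> decreases in \<open>u\<close>, that is, increases in \<open>r\<close>. One finds
  \<open>E = \<pi>/sin(\<pi> a) \<cdot> r\<^sup>2 F(1 - r\<^sup>2) \<cdot> H(r\<^sup>2)\<close> with \<open>H(z) = F(z) - 2 (1 - z) F'(z)\<close>. The factor
  \<open>r\<^sup>2 F(1 - r\<^sup>2)\<close> increases because \<open>(1 - x) F(x)\<close> decreases, and \<open>H\<close> has positive Taylor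
  coefficients; both facts are read off from the power series of \<open>(1 - x) F'(x)\<close>.
\<close>

section \<open>Monotone elasticity and tangent-line bounds\<close>

text \<open>
  \<open>E u\<close> is the logarithmic derivative of \<open>G\<close> with respect to \<open>ln u\<close>, so that its monotonicity
  says that \<open>ln G\<close> is strictly concave as a function of \<open>ln u\<close>.
\<close>

locale decreasing_elasticity =
  fixes y G E :: "real \<Rightarrow> real"
  assumes y_deriv: "\<And>u. 0 < u \<Longrightarrow> (y has_real_derivative G u) (at u)"
    and G_deriv: "\<And>u. 0 < u \<Longrightarrow> (G has_real_derivative E u * G u / u) (at u)"
    and G_pos: "\<And>u. 0 < u \<Longrightarrow> 0 < G u"
    and E_pos: "\<And>u. 0 < u \<Longrightarrow> 0 < E u"
    and E_strict_antimono: "\<And>u v. 0 < u \<Longrightarrow> u < v \<Longrightarrow> E v < E u"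
    and y_tendsto_0: "(y \<longlongrightarrow> 0) (at_right 0)"
    and G_tendsto_1: "(G \<longlongrightarrow> 1) at_top"
begin

lemma G_strict_mono:
  assumes "0 < u" "u < v"
  shows "G u < G v"
proof (rule DERIV_pos_imp_increasing[OF assms(2)])
  fix x assume "u \<le> x" "x \<le> v"
  then have "0 < x" using assms by simp
  then show "\<exists>d. (G has_real_derivative d) (at x) \<and> 0 < d"
    using G_deriv E_pos G_pos by (intro exI[of _ "E x * G x / x"]) auto
qed

lemma G_scaled_deriv:
  assumes "0 < k" "0 < w"
  shows "((\<lambda>k. G (k * w)) has_real_derivative E (k * w) * G (k * w) / k) (at k)"
proof -
  have "((\<lambda>k. G (k * w)) has_real_derivative E (k * w) * G (k * w) / (k * w) * w) (at k)"
    by (rule DERIV_chain2[where f = G and g = "\<lambda>k. k * w"])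
       (use assms in \<open>auto intro!: G_deriv derivative_eq_intros\<close>)
  then show ?thesis using assms by simp
qed

text \<open>
  This is the log-concavity in multiplicative form: the logarithmic derivative of the quotient
  in \<open>k\<close> is \<open>(E (k * v) - E (k * w)) / k\<close>.
\<close>

lemma G_quotient_strict_mono:
  assumes "0 < v" "v < w" "0 < k" "k < n"
  shows "G (k * v) / G (k * w) < G (n * v) / G (n * w)"
proof (rule DERIV_pos_imp_increasing[OF assms(4)])
  fix x assume "k \<le> x" "x \<le> n"
  then have x: "0 < x" using assms by simp
  have w: "0 < w" using assms by simp
  have pos: "0 < G (x * v)" "0 < G (x * w)" using x w assms by (auto intro!: G_pos)
  have "E (x * w) < E (x * v)" using x w assms by (intro E_strict_antimono) auto
  then have "0 < (E (x * v) - E (x * w)) * (G (x * v) * G (x * w)) / (x * (G (x * w))\<^sup>2)"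
    using x pos by simp
  moreover have "((\<lambda>x. G (x * v) / G (x * w)) has_real_derivative
      (E (x * v) - E (x * w)) * (G (x * v) * G (x * w)) / (x * (G (x * w))\<^sup>2)) (at x)"
    by (rule derivative_eq_intros G_scaled_deriv[OF x assms(1)] G_scaled_deriv[OF x w] refl)+
       (use x pos in \<open>auto simp: field_simps power2_eq_square\<close>)
  ultimately show "\<exists>d. ((\<lambda>x. G (x * v) / G (x * w)) has_real_derivative d) (at x) \<and> 0 < d"
    by blast
qed

end

locale balanced_triple = decreasing_elasticity +
  fixes p q s :: real
  assumes p: "0 < p" "p < s" and q: "0 < q" "q < s"
    and balance: "y p + y q = y s"
begin

definition defect :: "real \<Rightarrow> real" where
  "defect k = y (k * p) + y (k * q) - y (k * s)"

definition slope :: "real \<Rightarrow> real" where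
  "slope k = p * G (k * p) + q * G (k * q) - s * G (k * s)"

lemma s_pos: "0 < s" using p by simp

lemma defect_1 [simp]: "defect 1 = 0"
  using balance by (simp add: defect_def)

lemma y_scaled_deriv:
  assumes "0 < k" "0 < w"
  shows "((\<lambda>k. y (k * w)) has_real_derivative w * G (k * w)) (at k)"
proof -
  have "((\<lambda>k. y (k * w)) has_real_derivative G (k * w) * w) (at k)"
    by (rule DERIV_chain2[where f = y and g = "\<lambda>k. k * w"])
       (use assms in \<open>auto intro!: y_deriv derivative_eq_intros\<close>)
  then show ?thesis by (simp add: mult.commute)
qed

lemma defect_deriv:
  assumes "0 < k"
  shows "(defect has_real_derivative slope k) (at k)"
  unfolding defect_def slope_def
  by (rule derivative_eq_intros y_scaled_deriv[OF assms] p q s_pos refl)+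

lemma defect_tendsto_0: "(defect \<longlongrightarrow> 0) (at_right 0)"
proof -
  have "((\<lambda>k. y (k * w)) \<longlongrightarrow> 0) (at_right 0)" if "0 < w" for w
  proof (rule filterlim_compose[OF y_tendsto_0])
    have "((\<lambda>k. k * w) \<longlongrightarrow> 0 * w) (at_right 0)" by (intro tendsto_intros)
    moreover have "\<forall>\<^sub>F k in at_right 0. k * w \<in> {0<..} \<and> k * w \<noteq> 0"
      using that by (auto intro!: eventually_at_right_less[THEN eventually_mono])
    ultimately show "filterlim (\<lambda>k. k * w) (at_right 0) (at_right 0)"
      by (simp add: filterlim_at)
  qed
  from this[OF p(1)] this[OF q(1)] this[OF s_pos]
  have "((\<lambda>k. y (k * p) + y (k * q) - y (k * s)) \<longlongrightarrow> 0 + 0 - 0) (at_right 0)"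
    by (intro tendsto_intros)
  then show ?thesis unfolding defect_def by simp
qed

text \<open>
  The sign of \<open>slope k\<close> is that of \<open>slope_ratio k - 1\<close>, and the ratio is monotone in \<open>k\<close> even
  where the slope itself is not.
\<close>

definition slope_ratio :: "real \<Rightarrow> real" where
  "slope_ratio k = (p * (G (k * p) / G (k * s)) + q * (G (k * q) / G (k * s))) / s"

lemma slope_ratio_strict_mono:
  assumes "0 < k" "k < n"
  shows "slope_ratio k < slope_ratio n"
  unfolding slope_ratio_def using s_pos p q assms
  by (intro divide_strict_right_mono add_strict_mono mult_strict_left_mono
        G_quotient_strict_mono) auto

lemma slope_eq_ratio:
  assumes "0 < k"
  shows "slope k = s * G (k * s) * (slope_ratio k - 1)"
proof -
  have "0 < G (k * s)" using assms s_pos by (simp add: G_pos)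
  then show ?thesis
    using s_pos by (simp add: slope_def slope_ratio_def field_simps)
qed

text \<open>
  If the ratio were at most 1 at \<open>k = 1\<close>, the slope would be negative on the whole of \<open>(0,1)\<close>. A
  function that decreases to its value 0 at \<open>k = 1\<close> cannot tend to 0 at \<open>k = 0\<close>.
\<close>

lemma slope_ratio_1_gt: "1 < slope_ratio 1"
proof (rule ccontr)
  assume "\<not> 1 < slope_ratio 1"
  then have neg: "slope k < 0" if "0 < k" "k < 1" for k
    using slope_ratio_strict_mono[OF that] that s_pos G_pos[of "k * s"]
    by (simp add: slope_eq_ratio mult_pos_neg)
  have decr: "defect n < defect k" if "0 < k" "k < n" "n \<le> 1" for k n
  proof (rule DERIV_neg_imp_decreasing_open[OF that(2)])
    show "\<exists>d. (defect has_real_derivative d) (at x) \<and> d < 0" if "k < x" "x < n" for x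
      using that \<open>0 < k\<close> \<open>n \<le> 1\<close> neg[of x] defect_deriv[of x] by auto
    show "continuous_on {k..n} defect"
      using \<open>0 < k\<close> by (intro DERIV_atLeastAtMost_imp_continuous_on exI[of _ "slope _"])
        (auto intro: defect_deriv)
  qed
  have "\<forall>\<^sub>F k in at_right 0. defect (1/2) \<le> defect k"
    unfolding eventually_at_right_field
    by (intro exI[of _ "1/2"]) (auto intro!: less_imp_le decr)
  then have "defect (1/2) \<le> 0"
    by (intro tendsto_lowerbound[OF defect_tendsto_0]) auto
  moreover have "0 < defect (1/2)"
    using decr[of "1/2" 1] by simp
  ultimately show False by simp
qed

text \<open>
  Substitute for convexity. Where the ratio is at most 1, the slope is nonpositive and so below
  its positive value at \<open>n\<close>; where the ratio exceeds 1, the slope is a product of two increasing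
  positive factors. The estimate treats both cases at once: the ratio is moved to \<open>n\<close> first, where
  it exceeds 1, so that afterwards \<open>G (k * s)\<close> may be increased to \<open>G (n * s)\<close>.
\<close>

lemma slope_strict_mono_above:
  assumes "0 < k" "k < n" "1 \<le> n"
  shows "slope k < slope n"
proof -
  have n: "0 < n" "1 < slope_ratio n"
    using assms slope_ratio_1_gt slope_ratio_strict_mono[of 1 n] by (cases "n = 1"; force)+
  have G: "0 < G (k * s)" "G (k * s) < G (n * s)"
    using assms s_pos by (auto intro!: G_pos G_strict_mono)
  have "slope k < s * G (k * s) * (slope_ratio n - 1)"
    using slope_ratio_strict_mono[OF assms(1,2)] assms G s_pos by (simp add: slope_eq_ratio)
  also have "\<dots> \<le> slope n"
    using G s_pos n by (simp add: slope_eq_ratio)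
  finally show ?thesis .
qed

lemma slope_tendsto: "(slope \<longlongrightarrow> p + q - s) at_top"
proof -
  have "((\<lambda>k. G (k * w)) \<longlongrightarrow> 1) at_top" if "0 < w" for w
    by (rule filterlim_compose[OF G_tendsto_1])
       (rule filterlim_at_top_mult_tendsto_pos[OF tendsto_const that filterlim_ident])
  from this[OF p(1)] this[OF q(1)] this[OF s_pos]
  have "((\<lambda>k. p * G (k * p) + q * G (k * q) - s * G (k * s)) \<longlongrightarrow> p * 1 + q * 1 - s * 1) at_top"
    by (intro tendsto_intros)
  then show ?thesis unfolding slope_def by simp
qed

lemma slope_less_limit:
  assumes "1 \<le> k"
  shows "slope k < p + q - s"
proof -
  have "\<forall>\<^sub>F n in at_top. slope (k + 1) \<le> slope n"
    using eventually_gt_at_top[of "k + 1"]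
    by eventually_elim (use assms in \<open>auto intro!: less_imp_le slope_strict_mono_above\<close>)
  then have "slope (k + 1) \<le> p + q - s"
    by (intro tendsto_lowerbound[OF slope_tendsto]) auto
  then show ?thesis using slope_strict_mono_above[of k "k + 1"] assms by simp
qed

lemma defect_mean_value:
  assumes "0 < k" "k < n"
  obtains z where "k < z" "z < n" "defect n - defect k = (n - k) * slope z"
proof -
  have "\<exists>z>k. z < n \<and> defect n - defect k = (n - k) * slope z"
    using assms by (intro MVT2 defect_deriv) auto
  then show ?thesis using that by blast
qed

lemma defect_quotient_tendsto: "((\<lambda>k. defect k / (k - 1)) \<longlongrightarrow> slope 1) (at 1)"
  using defect_deriv[of 1] by (simp add: has_field_derivative_iff)

text \<open>
  The next three equivalences have the same shape. The constant suffices because the mean value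
  theorem turns a bound on the slope into a bound on the defect, which vanishes at 1. It is
  necessary by the limit of the difference quotient at 1, or at infinity by the limit of the slope.
\<close>

theorem defect_bound_below_iff:
  "(\<forall>k\<in>{0<..<1}. - defect k < c * (1 - k)) \<longleftrightarrow> slope 1 \<le> c"
proof
  assume c: "slope 1 \<le> c"
  show "\<forall>k\<in>{0<..<1}. - defect k < c * (1 - k)"
  proof
    fix k :: real assume "k \<in> {0<..<1}"
    then have k: "0 < k" "k < 1" by auto
    obtain z where z: "k < z" "z < 1" "defect 1 - defect k = (1 - k) * slope z"
      using defect_mean_value[OF k] .
    have "slope z < c" using slope_strict_mono_above[of z 1] z k c by simp
    then have "(1 - k) * slope z < (1 - k) * c" using k by simp
    then show "- defect k < c * (1 - k)" using z(3) by (simp add: mult.commute)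
  qed
next
  assume *: "\<forall>k\<in>{0<..<1}. - defect k < c * (1 - k)"
  have "\<forall>\<^sub>F k in at_left 1. defect k / (k - 1) \<le> c"
    unfolding eventually_at_left_field
  proof (intro exI[of _ 0] conjI allI impI)
    fix k :: real assume "0 < k" "k < 1"
    then have "- defect k < c * (1 - k)" using * by simp
    then show "defect k / (k - 1) \<le> c" using \<open>k < 1\<close> by (simp add: field_simps)
  qed simp
  then show "slope 1 \<le> c"
    by (intro tendsto_upperbound[OF tendsto_mono[OF _ defect_quotient_tendsto]])
       (auto simp: at_le)
qed

theorem defect_bound_above_iff:
  "(\<forall>k\<in>{1<..}. - defect k < c * (1 - k)) \<longleftrightarrow> c \<le> slope 1"
proof
  assume c: "c \<le> slope 1"
  show "\<forall>k\<in>{1<..}. - defect k < c * (1 - k)"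
  proof
    fix k :: real assume "k \<in> {1<..}"
    then have k: "1 < k" by auto
    obtain z where z: "1 < z" "z < k" "defect k - defect 1 = (k - 1) * slope z"
      using defect_mean_value[OF _ k] by auto
    have "c < slope z" using slope_strict_mono_above[of 1 z] z c by simp
    then have "(k - 1) * c < (k - 1) * slope z" using k by simp
    then show "- defect k < c * (1 - k)" using z(3) by (simp add: algebra_simps)
  qed
next
  assume *: "\<forall>k\<in>{1<..}. - defect k < c * (1 - k)"
  have "\<forall>\<^sub>F k in at_right 1. c \<le> defect k / (k - 1)"
    unfolding eventually_at_right_field
  proof (intro exI[of _ 2] conjI allI impI)
    fix k :: real assume "1 < k" "k < 2"
    then have "- defect k < c * (1 - k)" using * by simp
    then show "c \<le> defect k / (k - 1)" using \<open>1 < k\<close> by (simp add: field_simps)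
  qed simp
  then show "c \<le> slope 1"
    by (intro tendsto_lowerbound[OF tendsto_mono[OF _ defect_quotient_tendsto]])
       (auto simp: at_le)
qed

theorem defect_lower_bound_iff:
  "(\<forall>k\<in>{1<..}. c * (1 - k) < - defect k) \<longleftrightarrow> p + q - s \<le> c"
proof
  assume c: "p + q - s \<le> c"
  show "\<forall>k\<in>{1<..}. c * (1 - k) < - defect k"
  proof
    fix k :: real assume "k \<in> {1<..}"
    then have k: "1 < k" by auto
    obtain z where z: "1 < z" "z < k" "defect k - defect 1 = (k - 1) * slope z"
      using defect_mean_value[OF _ k] by auto
    have "slope z < c" using slope_less_limit[of z] z c by simp
    then have "(k - 1) * slope z < (k - 1) * c" using k by simp
    then show "c * (1 - k) < - defect k" using z(3) by (simp add: algebra_simps)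
  qed
next
  assume *: "\<forall>k\<in>{1<..}. c * (1 - k) < - defect k"
  show "p + q - s \<le> c"
  proof (rule ccontr)
    assume "\<not> p + q - s \<le> c"
    then obtain e where e: "c < e" "e < p + q - s" using dense not_le by blast
    have "\<forall>\<^sub>F k in at_top. e < slope k" using slope_tendsto e(2) by (rule order_tendstoD)
    then obtain k0 where k0: "\<And>k. k0 \<le> k \<Longrightarrow> e < slope k"
      by (auto simp: eventually_at_top_linorder)
    define k1 where "k1 = max k0 2"
    have k1: "1 < k1" "\<And>k. k1 \<le> k \<Longrightarrow> e < slope k" using k0 by (auto simp: k1_def)
    \<comment> \<open>Beyond \<open>k1\<close> the defect grows at rate at least \<open>e\<close>, hence eventually exceeds the line of
      smaller slope \<open>c\<close>; \<open>n\<close> is chosen so large that the initial difference is used up.\<close>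
    define n where "n = k1 + 1 + \<bar>e * k1 - c - defect k1\<bar> / (e - c)"
    have "(e - c) * n = (e - c) * (k1 + 1) + \<bar>e * k1 - c - defect k1\<bar>"
      using e by (simp add: n_def field_simps)
    moreover have "0 < (e - c) * (k1 + 1)" using e k1 by simp
    ultimately have big: "e * k1 - c - defect k1 < (e - c) * n" by linarith
    have n: "k1 < n" using e by (simp add: n_def add_pos_nonneg)
    obtain z where z: "k1 < z" "z < n" "defect n - defect k1 = (n - k1) * slope z"
      using defect_mean_value[OF _ n] k1 by auto
    have "(n - k1) * e < (n - k1) * slope z" using n z k1 by simp
    moreover have "c * (1 - n) < - defect n" using * n k1 by simp
    ultimately show False using z(3) big by (simp add: algebra_simps)
  qed
qed

end

section \<open>Power series near the boundary point 1\<close>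

text \<open>
  Multiplication by \<open>1 - x\<close> replaces the coefficients by their successive differences. The
  conditional encodes the coefficient \<open>c (-1) = 0\<close>.
\<close>

lemma one_minus_mult_powser:
  fixes c :: "nat \<Rightarrow> real"
  assumes "summable (\<lambda>n. c n * x ^ n)"
  shows "(\<lambda>n. (c n - (if n = 0 then 0 else c (n - 1))) * x ^ n) sums ((1 - x) * (\<Sum>n. c n * x ^ n))"
proof -
  let ?S = "\<Sum>n. c n * x ^ n"
  have "(\<lambda>n. c n * x ^ n) sums ?S" using assms by (rule summable_sums)
  moreover from this have "(\<lambda>n. c n * x ^ n * x) sums (?S * x)" by (rule sums_mult2)
  then have "(\<lambda>n. (if Suc n = 0 then 0 else c (Suc n - 1)) * x ^ Suc n) sums (?S * x)"
    by (simp add: mult_ac)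
  then have "(\<lambda>n. (if n = 0 then 0 else c (n - 1)) * x ^ n) sums (?S * x)"
    by (subst (asm) sums_Suc_iff) simp
  ultimately have "(\<lambda>n. c n * x ^ n - (if n = 0 then 0 else c (n - 1)) * x ^ n) sums (?S - ?S * x)"
    by (rule sums_diff)
  then show ?thesis by (simp only: left_diff_distrib right_diff_distrib mult_1 mult.commute[of x])
qed

lemma summable_powser_bounded:
  fixes c :: "nat \<Rightarrow> real"
  assumes "\<And>n. \<bar>c n\<bar> \<le> B" "\<bar>x\<bar> < 1"
  shows "summable (\<lambda>n. c n * x ^ n)"
proof (rule summable_comparison_test')
  show "summable (\<lambda>n. B * \<bar>x\<bar> ^ n)" using assms by (intro summable_mult summable_geometric) auto
  show "norm (c n * x ^ n) \<le> B * \<bar>x\<bar> ^ n" for n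
    using assms(1)[of n] by (simp add: abs_mult power_abs mult_right_mono)
qed

lemma powser_ge_head:
  fixes c :: "nat \<Rightarrow> real"
  assumes "(\<lambda>n. c n * x ^ n) sums S" "\<And>n. 0 \<le> c n" "0 \<le> x"
  shows "c 0 \<le> S"
proof -
  have "(\<Sum>n\<in>{0}. c n * x ^ n) \<le> (\<Sum>n. c n * x ^ n)"
    using assms by (intro sum_le_suminf) (auto simp: sums_iff)
  then show ?thesis using assms by (simp add: sums_iff)
qed

text \<open>
  Since \<open>(1 - x) * (\<Sum>n. x ^ n) = 1\<close>, the left-hand side is a weighted mean of the coefficients,
  whose weights move to infinity as \<open>x\<close> tends to 1. The finitely many coefficients that are not yet
  close to the limit contribute at most \<open>(1 - x) * M\<close>.
\<close>

lemma abelian_limit: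
  fixes c :: "nat \<Rightarrow> real"
  assumes "c \<longlonglongrightarrow> l"
  shows "((\<lambda>x. (1 - x) * (\<Sum>n. c n * x ^ n)) \<longlongrightarrow> l) (at_left 1)"
proof (rule tendstoI)
  fix e :: real assume e: "0 < e"
  obtain B where B: "\<And>n. \<bar>c n\<bar> \<le> B"
    using convergent_imp_bounded[OF assms] by (auto simp: bounded_iff)
  obtain N where N: "\<And>n. N \<le> n \<Longrightarrow> \<bar>c n - l\<bar> < e / 2"
    using LIMSEQ_D[OF assms, of "e / 2"] e by auto
  define M where "M = (\<Sum>n<N. \<bar>c n - l\<bar>)"
  have M0: "0 \<le> M" by (simp add: M_def sum_nonneg)
  have close: "\<bar>(1 - x) * (\<Sum>n. c n * x ^ n) - l\<bar> \<le> (1 - x) * M + e / 2" if x: "0 < x" "x < 1" for x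
  proof -
    have geo: "(\<lambda>n. x ^ n) sums (1 / (1 - x))" using x by (intro geometric_sums) auto
    have sc: "summable (\<lambda>n. c n * x ^ n)" using summable_powser_bounded[OF B] x by simp
    have "(\<lambda>n. c n * x ^ n - l * x ^ n) sums ((\<Sum>n. c n * x ^ n) - l * (1 / (1 - x)))"
      by (intro sums_diff summable_sums sc sums_mult geo)
    then have h: "(\<lambda>n. (c n - l) * x ^ n) sums ((\<Sum>n. c n * x ^ n) - l * (1 / (1 - x)))"
      by (simp add: left_diff_distrib)
    have fin: "(\<lambda>n. if n < N then \<bar>c n - l\<bar> else 0) sums M"
      using sums_If_finite_set[of "{..<N}" "\<lambda>n. \<bar>c n - l\<bar>"] by (simp add: M_def)
    have maj: "(\<lambda>n. (if n < N then \<bar>c n - l\<bar> else 0) + e / 2 * x ^ n) sums (M + e / 2 * (1 / (1 - x)))"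
      by (intro sums_add fin sums_mult geo)
    have bound: "\<bar>(c n - l) * x ^ n\<bar> \<le> (if n < N then \<bar>c n - l\<bar> else 0) + e / 2 * x ^ n" for n
    proof (cases "n < N")
      case True
      have "\<bar>c n - l\<bar> * x ^ n \<le> \<bar>c n - l\<bar> * 1"
        using x by (intro mult_left_mono power_le_one) auto
      moreover have "0 \<le> e / 2 * x ^ n" using e x by simp
      ultimately show ?thesis using True x by (simp add: abs_mult)
    next
      case False
      then have "\<bar>c n - l\<bar> * x ^ n \<le> e / 2 * x ^ n"
        using N[of n] x by (intro mult_right_mono) auto
      then show ?thesis using False x by (simp add: abs_mult)
    qed
    have "\<bar>(\<Sum>n. c n * x ^ n) - l * (1 / (1 - x))\<bar> \<le> M + e / 2 * (1 / (1 - x))"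
    proof (rule abs_leI)
      show "(\<Sum>n. c n * x ^ n) - l * (1 / (1 - x)) \<le> M + e / 2 * (1 / (1 - x))"
        using bound by (intro sums_le[OF _ h maj]) (use abs_le_D1 in blast)
      show "- ((\<Sum>n. c n * x ^ n) - l * (1 / (1 - x))) \<le> M + e / 2 * (1 / (1 - x))"
        using bound by (intro sums_le[OF _ sums_minus[OF h] maj]) (use abs_le_D2 in blast)
    qed
    then have "(1 - x) * \<bar>(\<Sum>n. c n * x ^ n) - l * (1 / (1 - x))\<bar> \<le> (1 - x) * (M + e / 2 * (1 / (1 - x)))"
      using x by (intro mult_left_mono) auto
    moreover have "(1 - x) * \<bar>(\<Sum>n. c n * x ^ n) - l * (1 / (1 - x))\<bar> = \<bar>(1 - x) * (\<Sum>n. c n * x ^ n) - l\<bar>"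
    proof -
      have "(1 - x) * \<bar>(\<Sum>n. c n * x ^ n) - l * (1 / (1 - x))\<bar>
          = \<bar>(1 - x) * ((\<Sum>n. c n * x ^ n) - l * (1 / (1 - x)))\<bar>"
        using x by (simp add: abs_mult)
      also have "(1 - x) * ((\<Sum>n. c n * x ^ n) - l * (1 / (1 - x))) = (1 - x) * (\<Sum>n. c n * x ^ n) - l"
        using x by (simp add: right_diff_distrib)
      finally show ?thesis .
    qed
    moreover have "(1 - x) * (M + e / 2 * (1 / (1 - x))) = (1 - x) * M + e / 2"
      using x by (simp add: field_simps)
    ultimately show ?thesis by simp
  qed
  have "((\<lambda>x. (1 - x) * M + e / 2) \<longlongrightarrow> (1 - 1) * M + e / 2) (at_left 1)"
    by (intro tendsto_intros)
  then have "\<forall>\<^sub>F x in at_left 1. (1 - x) * M + e / 2 < e"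
    using e by (elim order_tendstoD(2)) auto
  moreover have "\<forall>\<^sub>F x in at_left 1. (0::real) < x \<and> x < 1"
    unfolding eventually_at_left_field by (intro exI[of _ 0]) auto
  ultimately show "\<forall>\<^sub>F x in at_left 1. dist ((1 - x) * (\<Sum>n. c n * x ^ n)) l < e"
    by eventually_elim (use close in \<open>force simp: dist_real_def\<close>)
qed

section \<open>The function F(a, 1 - a; 1; x)\<close>

locale hypergeometric_parameter =
  fixes a :: real
  assumes a_gt_0: "0 < a" and a_less_1: "a < 1"
begin

definition A :: "nat \<Rightarrow> real" where
  "A n = pochhammer a n * pochhammer (1 - a) n / (fact n)\<^sup>2"

definition F :: "real \<Rightarrow> real" where
  "F x = (\<Sum>n. A n * x ^ n)"

definition F' :: "real \<Rightarrow> real" where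
  "F' x = (\<Sum>n. diffs A n * x ^ n)"

lemma hyp2F1_eq_F: "hyp2F1 a (1 - a) 1 x = F x"
  unfolding hyp2F1_def F_def A_def
  by (simp add: pochhammer_fact[symmetric] power2_eq_square mult_ac)

lemma prod_bounds: "0 < a * (1 - a)" "a * (1 - a) \<le> 1 / 4"
proof -
  show "0 < a * (1 - a)" using a_gt_0 a_less_1 by simp
  have "0 \<le> (a - 1 / 2)\<^sup>2" by simp
  then show "a * (1 - a) \<le> 1 / 4" by (simp add: power2_eq_square algebra_simps)
qed

lemma A_0 [simp]: "A 0 = 1" by (simp add: A_def)

lemma A_Suc: "A (Suc n) = A n * ((real n * (real n + 1) + a * (1 - a)) / (real n + 1)\<^sup>2)"
proof -
  have "(a + real n) * (1 - a + real n) = real n * (real n + 1) + a * (1 - a)"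
    by (simp add: algebra_simps)
  moreover have "A (Suc n) = A n * ((a + real n) * (1 - a + real n) / (real n + 1)\<^sup>2)"
    by (simp add: A_def pochhammer_Suc power2_eq_square field_simps)
  ultimately show ?thesis by simp
qed

lemma A_pos: "0 < A n"
  using a_gt_0 a_less_1 by (simp add: A_def pochhammer_pos)

lemma A_le_1: "A n \<le> 1"
proof (induction n)
  case (Suc n)
  have "real n * (real n + 1) + a * (1 - a) \<le> (real n + 1)\<^sup>2"
    using prod_bounds by (simp add: power2_eq_square algebra_simps)
  then have "(real n * (real n + 1) + a * (1 - a)) / (real n + 1)\<^sup>2 \<le> 1" by simp
  moreover have "0 \<le> (real n * (real n + 1) + a * (1 - a)) / (real n + 1)\<^sup>2"
    using prod_bounds by (intro divide_nonneg_nonneg add_nonneg_nonneg) auto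
  ultimately have "A n * ((real n * (real n + 1) + a * (1 - a)) / (real n + 1)\<^sup>2) \<le> 1"
    using Suc A_pos[of n] by (intro mult_le_one) auto
  then show ?case by (simp only: A_Suc)
qed simp

lemma summable_A: "\<bar>x\<bar> < 1 \<Longrightarrow> summable (\<lambda>n. A n * x ^ n)"
  by (rule summable_powser_bounded[of _ 1]) (use A_le_1 in \<open>auto simp: abs_of_pos A_pos\<close>)

lemma summable_diffs_A: "\<bar>x\<bar> < 1 \<Longrightarrow> summable (\<lambda>n. diffs A n * x ^ n)"
  by (rule termdiff_converges[of _ 1]) (auto intro: summable_A)

lemma F_deriv: "\<bar>x\<bar> < 1 \<Longrightarrow> (F has_real_derivative F' x) (at x)"
  unfolding F_def F'_def by (rule termdiffs_strong'[of 1]) (auto intro: summable_A)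

lemma isCont_F': "\<bar>x\<bar> < 1 \<Longrightarrow> isCont F' x"
  unfolding F'_def
  by (rule DERIV_isCont, rule termdiffs_strong'[of 1]) (auto intro: summable_diffs_A)

lemma F_0 [simp]: "F 0 = 1" by (simp add: F_def powser_zero)

lemma diffs_A_step: "diffs A (Suc n) - diffs A n = a * (1 - a) * A (Suc n) / (real n + 2)"
proof -
  have "diffs A (Suc n) = (real n + 2) * A (Suc (Suc n))" by (simp add: diffs_def)
  also have "\<dots> = A (Suc n) * (((real n + 1) * (real n + 2) + a * (1 - a)) / (real n + 2))"
  proof -
    have "k * (x * (c / k\<^sup>2)) = x * (c / k)" if "0 < k" for k x c :: real
      using that by (simp add: power2_eq_square)
    from this[of "real n + 2"] show ?thesis
      unfolding A_Suc[of "Suc n"] by (simp add: add.commute)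
  qed
  finally have "diffs A (Suc n) = A (Suc n) * (((real n + 1) * (real n + 2) + a * (1 - a)) / (real n + 2))" .
  moreover have "diffs A n = A (Suc n) * (real n + 1)" by (simp add: diffs_def)
  moreover have "((real n + 1) * (real n + 2) + a * (1 - a)) / (real n + 2) =
      real n + 1 + a * (1 - a) / (real n + 2)"
    by (simp add: add_divide_distrib)
  ultimately show ?thesis by (simp only: distrib_left) simp
qed

text \<open>
  The coefficients of \<open>(1 - x) F'(x)\<close> are simple multiples of those of \<open>F\<close>. This series carries
  the hypergeometric differential equation, and comparing it with that of \<open>F\<close> coefficient by
  coefficient gives the monotonicity and positivity facts below.
\<close>

lemma one_minus_mult_F':
  assumes "\<bar>x\<bar> < 1"
  shows "(\<lambda>n. a * (1 - a) * A n / (real n + 1) * x ^ n) sums ((1 - x) * F' x)"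
proof -
  have "diffs A n - (if n = 0 then 0 else diffs A (n - 1)) = a * (1 - a) * A n / (real n + 1)" for n
    using diffs_A_step[of "n - 1"] A_Suc[of 0] by (cases n) (auto simp: diffs_def algebra_simps)
  then show ?thesis
    using one_minus_mult_powser[OF summable_diffs_A[OF assms]] by (simp add: F'_def)
qed

lemma F_ge_1:
  assumes "0 \<le> x" "x < 1"
  shows "1 \<le> F x"
proof -
  have "A 0 \<le> F x"
    unfolding F_def using assms less_imp_le[OF A_pos]
    by (intro powser_ge_head[OF summable_sums[OF summable_A]]) auto
  then show ?thesis by simp
qed

lemma one_minus_mult_F_strict_antimono:
  assumes "0 \<le> x" "x < z" "z < 1"
  shows "(1 - z) * F z < (1 - x) * F x"
proof (rule DERIV_neg_imp_decreasing[OF assms(2)])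
  fix w assume "x \<le> w" "w \<le> z"
  then have w: "0 \<le> w" "w < 1" using assms by auto
  have "(1 - w) * F' w < F w"
  proof -
    have w': "\<bar>w\<bar> < 1" using w by simp
    have "(\<lambda>n. A n * w ^ n - a * (1 - a) * A n / (real n + 1) * w ^ n) sums (F w - (1 - w) * F' w)"
      unfolding F_def by (intro sums_diff one_minus_mult_F' summable_sums summable_A w')
    moreover have "A n * w ^ n - a * (1 - a) * A n / (real n + 1) * w ^ n
        = A n * (1 - a * (1 - a) / (real n + 1)) * w ^ n" for n
      by (simp add: field_simps)
    ultimately have s: "(\<lambda>n. A n * (1 - a * (1 - a) / (real n + 1)) * w ^ n) sums (F w - (1 - w) * F' w)"
      by simp
    have c: "0 < A n * (1 - a * (1 - a) / (real n + 1))" for n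
      using prod_bounds A_pos by (intro mult_pos_pos) (simp_all add: field_simps)
    show ?thesis
      using powser_ge_head[OF s less_imp_le[OF c] w(1)] c[of 0] by simp
  qed
  moreover have "((\<lambda>w. (1 - w) * F w) has_real_derivative (1 - w) * F' w - F w) (at w)"
    using w by (auto intro!: derivative_eq_intros F_deriv)
  ultimately show "\<exists>d. ((\<lambda>w. (1 - w) * F w) has_real_derivative d) (at w) \<and> d < 0"
    by (intro exI[of _ "(1 - w) * F' w - F w"]) simp
qed

text \<open>
  The logarithmic derivative of \<open>(1 - z) F(z)\<^sup>2\<close> is \<open>- H(z) / ((1 - z) F(z))\<close>.
\<close>

definition H :: "real \<Rightarrow> real" where
  "H z = F z - 2 * ((1 - z) * F' z)"

lemma H_sums:
  assumes "\<bar>z\<bar> < 1"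
  shows "(\<lambda>n. A n * (1 - 2 * (a * (1 - a)) / (real n + 1)) * z ^ n) sums H z"
proof -
  have "(\<lambda>n. A n * z ^ n - 2 * (a * (1 - a) * A n / (real n + 1) * z ^ n)) sums H z"
    unfolding H_def F_def by (intro sums_diff sums_mult one_minus_mult_F' summable_sums summable_A assms)
  moreover have "A n * z ^ n - 2 * (a * (1 - a) * A n / (real n + 1) * z ^ n)
      = A n * (1 - 2 * (a * (1 - a)) / (real n + 1)) * z ^ n" for n
    by (simp add: field_simps)
  ultimately show ?thesis by simp
qed

lemma H_coeff_pos: "0 < A n * (1 - 2 * (a * (1 - a)) / (real n + 1))"
  using prod_bounds A_pos by (intro mult_pos_pos) (simp_all add: field_simps)

lemma H_pos:
  assumes "0 \<le> z" "z < 1"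
  shows "0 < H z"
  using powser_ge_head[OF H_sums[of z] less_imp_le[OF H_coeff_pos] assms(1)] H_coeff_pos[of 0] assms
  by linarith

lemma H_mono:
  assumes "0 \<le> x" "x \<le> z" "z < 1"
  shows "H x \<le> H z"
proof (rule sums_le[OF _ H_sums H_sums])
  show "A n * (1 - 2 * (a * (1 - a)) / (real n + 1)) * x ^ n
      \<le> A n * (1 - 2 * (a * (1 - a)) / (real n + 1)) * z ^ n" for n
    using assms by (intro mult_left_mono power_mono less_imp_le[OF H_coeff_pos])
qed (use assms in auto)

text \<open>
  The constant coefficient of \<open>(1 - x) F'(x)\<close> is \<open>a (1 - a)\<close> and all others are positive, so
  \<open>F\<close> grows at least as fast as \<open>- a (1 - a) ln (1 - x)\<close>.
\<close>

lemma F_at_top: "filterlim F at_top (at_left 1)"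
proof (rule filterlim_at_top_mono)
  have "filterlim (\<lambda>x::real. - ln (1 - x)) at_top (at_left 1)"
  proof -
    have "((\<lambda>x::real. 1 - x) \<longlongrightarrow> 1 - 1) (at_left 1)" by (intro tendsto_intros)
    moreover have "\<forall>\<^sub>F x in at_left 1. 1 - x \<in> {0<..} \<and> 1 - x \<noteq> (0::real)"
      unfolding eventually_at_left_field by (intro exI[of _ 0]) auto
    ultimately have "filterlim (\<lambda>x::real. 1 - x) (at_right 0) (at_left 1)"
      by (simp add: filterlim_at)
    then have "filterlim (\<lambda>x::real. ln (1 - x)) at_bot (at_left 1)"
      by (rule filterlim_compose[OF ln_at_0])
    then show ?thesis by (simp add: filterlim_uminus_at_bot)
  qed
  then show "filterlim (\<lambda>x. a * (1 - a) * (- ln (1 - x))) at_top (at_left 1)"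
    using prod_bounds by (intro filterlim_tendsto_pos_mult_at_top[OF tendsto_const])
  have "a * (1 - a) * (- ln (1 - x)) \<le> F x" if x: "0 < x" "x < 1" for x
  proof -
    have "F 0 - a * (1 - a) * (- ln (1 - 0)) \<le> F x - a * (1 - a) * (- ln (1 - x))"
    proof (rule DERIV_nonneg_imp_nondecreasing[where f = "\<lambda>x. F x - a * (1 - a) * (- ln (1 - x))"])
      fix w assume "0 \<le> w" "w \<le> x"
      then have w: "0 \<le> w" "w < 1" using x by auto
      have "a * (1 - a) \<le> (1 - w) * F' w"
      proof -
        have "0 \<le> a * (1 - a) * A n / (real n + 1)" for n
          using prod_bounds A_pos[of n] by simp
        then show ?thesis using powser_ge_head[OF one_minus_mult_F'] w by fastforce
      qed
      then have "0 \<le> F' w - a * (1 - a) / (1 - w)" using w by (simp add: field_simps)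
      moreover have "((\<lambda>x. F x - a * (1 - a) * (- ln (1 - x))) has_real_derivative
          F' w - a * (1 - a) / (1 - w)) (at w)"
        using w by (auto intro!: derivative_eq_intros F_deriv)
      ultimately show "\<exists>d. ((\<lambda>x. F x - a * (1 - a) * (- ln (1 - x))) has_real_derivative d) (at w) \<and> 0 \<le> d"
        by blast
    qed (use x in simp)
    then show ?thesis by simp
  qed
  then show "\<forall>\<^sub>F x in at_left 1. a * (1 - a) * (- ln (1 - x)) \<le> F x"
    unfolding eventually_at_left_field by (intro exI[of _ 0]) auto
qed

text \<open>
  Up to the factor \<open>n / (n + 1)\<close> these coefficients are products of the Gauss approximations of
  \<open>1/\<Gamma>(a)\<close> and \<open>1/\<Gamma>(1 - a)\<close>, so the limit comes from the reflection formula.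
\<close>

lemma diffs_A_tendsto: "diffs A \<longlonglongrightarrow> sin (pi * a) / pi"
proof -
  have rG: "rGamma a * rGamma (1 - a) = sin (pi * a) / pi"
  proof -
    have "complex_of_real (rGamma a * rGamma (1 - a)) = of_real (sin (pi * a) / pi)"
    proof -
      have "1 - complex_of_real a = of_real (1 - a)" by simp
      then show ?thesis
        using rGamma_reflection_complex[of "of_real a"]
        by (simp only: rGamma_complex_of_real sin_of_real of_real_mult[symmetric]
              of_real_divide[symmetric])
    qed
    then show ?thesis by (simp only: of_real_eq_iff)
  qed
  have eq: "rGamma_series a n * rGamma_series (1 - a) n = diffs A n * ((real n + 1) / real n)"
    if "0 < n" for n
  proof -
    have e: "exp (a * ln (real n)) * exp ((1 - a) * ln (real n)) = real n"
      using that by (simp flip: exp_add add: algebra_simps)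
    have "rGamma_series a n * rGamma_series (1 - a) n =
        pochhammer a (n + 1) * pochhammer (1 - a) (n + 1) /
        ((fact n)\<^sup>2 * (exp (a * ln (real n)) * exp ((1 - a) * ln (real n))))"
      by (simp add: rGamma_series_def power2_eq_square mult_ac)
    also have "\<dots> = pochhammer a (n + 1) * pochhammer (1 - a) (n + 1) / ((fact n)\<^sup>2 * real n)"
      by (simp only: e)
    also have "\<dots> = diffs A n * ((real n + 1) / real n)"
    proof -
      have "k * (P / (k * f)\<^sup>2) * (k / m) = P / (f\<^sup>2 * m)" if "0 < k" for k P f m :: real
        using that by (simp add: power2_eq_square)
      from this[of "real n + 1"] show ?thesis
        by (simp add: diffs_def A_def add.commute)
    qed
    finally show ?thesis .
  qed
  have "(\<lambda>n. rGamma_series a n * rGamma_series (1 - a) n) \<longlonglongrightarrow> sin (pi * a) / pi"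
    unfolding rG[symmetric] by (intro tendsto_mult rGamma_series_LIMSEQ)
  moreover have "(\<lambda>n. real n / real (Suc n)) \<longlonglongrightarrow> 1" by (rule LIMSEQ_n_over_Suc_n)
  ultimately have "(\<lambda>n. rGamma_series a n * rGamma_series (1 - a) n * (real n / real (Suc n)))
      \<longlonglongrightarrow> sin (pi * a) / pi * 1" by (rule tendsto_mult)
  then show ?thesis
    unfolding mult_1_right
    by (rule Lim_transform_eventually)
       (use eventually_gt_at_top[of 0] in eventually_elim, simp add: eq add.commute)
qed

lemma A_tendsto_0: "A \<longlonglongrightarrow> 0"
proof -
  have "(\<lambda>n. diffs A n * (1 / real (Suc n))) \<longlonglongrightarrow> sin (pi * a) / pi * 0"
    by (intro tendsto_mult diffs_A_tendsto LIMSEQ_Suc[OF lim_1_over_n])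
  then have "(\<lambda>n. A (Suc n)) \<longlonglongrightarrow> 0" by (simp add: diffs_def del: of_nat_Suc)
  then show ?thesis by (rule LIMSEQ_imp_Suc)
qed

lemma one_minus_mult_F'_tendsto: "((\<lambda>x. (1 - x) * F' x) \<longlongrightarrow> sin (pi * a) / pi) (at_left 1)"
  unfolding F'_def by (rule abelian_limit[OF diffs_A_tendsto])

lemma one_minus_mult_F_tendsto: "((\<lambda>x. (1 - x) * F x) \<longlongrightarrow> 0) (at_left 1)"
  unfolding F_def by (rule abelian_limit[OF A_tendsto_0])

text \<open>
  The quantity \<open>x (1 - x) F'(x)\<close> of the hypergeometric equation in self-adjoint form
  \<open>(x (1 - x) F')' = a (1 - a) F\<close>.
\<close>

definition T :: "real \<Rightarrow> real" where
  "T x = x * ((1 - x) * F' x)"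

lemma T_deriv:
  assumes "\<bar>x\<bar> < 1"
  shows "(T has_real_derivative a * (1 - a) * F x) (at x)"
proof -
  define t where "t n = (if n = 0 then 0 else a * (1 - a) * A (n - 1) / real n)" for n
  have t: "(\<lambda>n. t n * w ^ n) sums T w" if "\<bar>w\<bar> < 1" for w
  proof -
    have "(\<lambda>n. w * (a * (1 - a) * A n / (real n + 1) * w ^ n)) sums T w"
      unfolding T_def by (intro sums_mult one_minus_mult_F' that)
    moreover have "w * (a * (1 - a) * A n / (real n + 1) * w ^ n) = t (Suc n) * w ^ Suc n" for n
      by (simp add: t_def add.commute)
    ultimately have "(\<lambda>n. t (Suc n) * w ^ Suc n) sums T w" by simp
    then show ?thesis by (subst (asm) sums_Suc_iff) (simp add: t_def)
  qed
  have "((\<lambda>x. \<Sum>n. t n * x ^ n) has_real_derivative (\<Sum>n. diffs t n * x ^ n)) (at x)"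
    by (rule termdiffs_strong'[of 1]) (use t assms in \<open>auto simp: sums_iff\<close>)
  moreover have "(\<Sum>n. diffs t n * x ^ n) = a * (1 - a) * F x"
  proof -
    have "diffs t n = a * (1 - a) * A n" for n by (simp add: diffs_def t_def del: of_nat_Suc)
    then show ?thesis
      unfolding F_def using suminf_mult[OF summable_A[OF assms], of "a * (1 - a)"]
      by (simp add: mult_ac)
  qed
  moreover have "\<forall>\<^sub>F w in nhds x. (\<Sum>n. t n * w ^ n) = T w"
  proof -
    have "\<forall>\<^sub>F w in nhds x. w \<in> {-1<..<1}" using assms by (intro eventually_nhds_in_open) auto
    then show ?thesis by eventually_elim (use t in \<open>auto simp: sums_iff\<close>)
  qed
  ultimately show ?thesis by (simp add: DERIV_cong_ev)
qed

lemma tendsto_flip_at_left_1: "isCont f 0 \<Longrightarrow> ((\<lambda>x. f (1 - x)) \<longlongrightarrow> f (0::real)) (at_left (1::real))"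
proof (rule isCont_tendsto_compose)
  have "((\<lambda>x::real. 1 - x) \<longlongrightarrow> 1 - 1) (at_left 1)" by (intro tendsto_intros)
  then show "((\<lambda>x::real. 1 - x) \<longlongrightarrow> 0) (at_left 1)" by simp
qed

text \<open>
  The left-hand side is, up to sign, \<open>x (1 - x)\<close> times the Wronskian of the solutions \<open>F(x)\<close> and
  \<open>F(1 - x)\<close>, hence constant. Its value is the limit at 1, where \<open>(1 - x) F'(x)\<close> tends to
  \<open>sin (\<pi> a) / \<pi>\<close> and the other summand vanishes because \<open>(1 - x) F(x)\<close> tends to 0.
\<close>

lemma legendre_relation:
  assumes "0 < x" "x < 1"
  shows "x * (1 - x) * (F' x * F (1 - x) + F x * F' (1 - x)) = sin (pi * a) / pi"
proof -
  define W where "W x = T x * F (1 - x) + F x * T (1 - x)" for x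
  have W_deriv: "(W has_real_derivative 0) (at w)" if "0 < w" "w < 1" for w
  proof -
    have flip: "((\<lambda>w. f (1 - w)) has_real_derivative - d) (at w)"
      if "(f has_real_derivative d) (at (1 - w))" for f :: "real \<Rightarrow> real" and d
    proof -
      have "((\<lambda>w. f (1 - w)) has_real_derivative d * (- 1)) (at w)"
        by (rule DERIV_chain2[where f = f and g = "\<lambda>w. 1 - w", OF that])
           (auto intro!: derivative_eq_intros)
      then show ?thesis by simp
    qed
    have "(W has_real_derivative a * (1 - a) * F w * F (1 - w) + - F' (1 - w) * T w
        + (F' w * T (1 - w) + - (a * (1 - a) * F (1 - w)) * F w)) (at w)"
      unfolding W_def using that
      by (intro DERIV_add DERIV_mult flip F_deriv T_deriv) auto
    then show ?thesis by (simp add: T_def algebra_simps)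
  qed
  have W_const: "W w = W x" if "0 < w" "w < 1" for w
    using DERIV_isconst3[of 0 1 w x W] W_deriv assms that by simp
  have "(W \<longlongrightarrow> sin (pi * a) / pi) (at_left 1)"
  proof -
    have id: "((\<lambda>x::real. x) \<longlongrightarrow> 1) (at_left 1)" by (rule tendsto_ident_at)
    have F1: "((\<lambda>x. F (1 - x)) \<longlongrightarrow> 1) (at_left 1)"
      using tendsto_flip_at_left_1[OF DERIV_isCont[OF F_deriv]] by simp
    have F2: "((\<lambda>x. F' (1 - x)) \<longlongrightarrow> F' 0) (at_left 1)"
      using tendsto_flip_at_left_1[OF isCont_F'] by simp
    have "((\<lambda>x. x * ((1 - x) * F' x) * F (1 - x) + x * ((1 - x) * F x) * F' (1 - x))
        \<longlongrightarrow> 1 * (sin (pi * a) / pi) * 1 + 1 * 0 * F' 0) (at_left 1)"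
      by (intro tendsto_intros id F1 F2 one_minus_mult_F'_tendsto one_minus_mult_F_tendsto)
    then show ?thesis unfolding W_def T_def by (simp add: mult_ac)
  qed
  moreover have "(W \<longlongrightarrow> W x) (at_left 1)"
  proof (rule tendsto_eventually)
    show "\<forall>\<^sub>F w in at_left 1. W w = W x"
      unfolding eventually_at_left_field by (intro exI[of _ 0]) (use W_const in auto)
  qed
  ultimately have "W x = sin (pi * a) / pi"
    by (intro tendsto_unique[of "at_left (1::real)" W]) auto
  then show ?thesis by (simp add: W_def T_def algebra_simps)
qed

section \<open>The generalized Groetzsch ring function and its inverse\<close>

lemma sin_pos: "0 < sin (pi * a)"
  using a_gt_0 a_less_1 by (intro sin_gt_zero) (auto simp: field_simps)

lemma mu_eq: "mu a r = pi / (2 * sin (pi * a)) * (F (1 - r\<^sup>2) / F (r\<^sup>2))"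
  by (simp add: mu_def hyp2F1_eq_F)

lemma square_bounds:
  assumes "r \<in> {0<..<1}"
  shows "0 < r\<^sup>2" "r\<^sup>2 < (1::real)"
  using assms by (auto simp: power_less_one_iff abs_square_less_1)

lemma F_square_pos:
  assumes "r \<in> {0<..<1}"
  shows "0 < F (r\<^sup>2)" "0 < F (1 - r\<^sup>2)"
  using F_ge_1[of "r\<^sup>2"] F_ge_1[of "1 - r\<^sup>2"] square_bounds[OF assms] by auto

lemma F_square_deriv:
  assumes "r \<in> {0<..<1}"
  shows "((\<lambda>r. F (r\<^sup>2)) has_real_derivative F' (r\<^sup>2) * (2 * r)) (at r)"
    and "((\<lambda>r. F (1 - r\<^sup>2)) has_real_derivative F' (1 - r\<^sup>2) * (- (2 * r))) (at r)"
proof -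
  note b = square_bounds[OF assms]
  show "((\<lambda>r. F (r\<^sup>2)) has_real_derivative F' (r\<^sup>2) * (2 * r)) (at r)"
    by (rule DERIV_chain2[where f = F, OF F_deriv])
       (use b in \<open>auto intro!: derivative_eq_intros\<close>)
  show "((\<lambda>r. F (1 - r\<^sup>2)) has_real_derivative F' (1 - r\<^sup>2) * (- (2 * r))) (at r)"
    by (rule DERIV_chain2[where f = F, OF F_deriv])
       (use b in \<open>auto intro!: derivative_eq_intros\<close>)
qed

text \<open>
  The normalisation \<open>\<pi> / (2 sin (\<pi> a))\<close> of \<open>\<mu>\<^sub>a\<close> is the one for which the constant of the
  Legendre relation cancels.
\<close>

lemma mu_deriv:
  assumes "r \<in> {0<..<1}"
  shows "(mu a has_real_derivative - inverse (r * (1 - r\<^sup>2) * (F (r\<^sup>2))\<^sup>2)) (at r)"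
proof -
  let ?z = "r\<^sup>2"
  have r: "r \<noteq> 0" using assms by simp
  note b = square_bounds[OF assms] and pos = F_square_pos[OF assms]
  have leg: "F' ?z * F (1 - ?z) + F ?z * F' (1 - ?z) = sin (pi * a) / pi / (?z * (1 - ?z))"
    using legendre_relation[OF b] b by (simp add: eq_divide_eq mult.commute)
  have "((\<lambda>r. pi / (2 * sin (pi * a)) * (F (1 - r\<^sup>2) / F (r\<^sup>2))) has_real_derivative
      pi / (2 * sin (pi * a)) *
        ((F' (1 - ?z) * (- (2 * r)) * F ?z - F (1 - ?z) * (F' ?z * (2 * r))) / (F ?z * F ?z))) (at r)"
    using pos by (intro DERIV_cmult DERIV_divide F_square_deriv assms) auto
  also have "F' (1 - ?z) * (- (2 * r)) * F ?z - F (1 - ?z) * (F' ?z * (2 * r))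
      = - 2 * r * (F' ?z * F (1 - ?z) + F ?z * F' (1 - ?z))"
    by (simp add: algebra_simps)
  also have "\<dots> = - 2 * r * (sin (pi * a) / pi / (?z * (1 - ?z)))" by (simp only: leg)
  also have "pi / (2 * sin (pi * a)) * (- 2 * r * (sin (pi * a) / pi / (?z * (1 - ?z))) / (F ?z * F ?z))
      = - inverse (r * (1 - ?z) * (F ?z)\<^sup>2)"
    using sin_pos r b pos by (simp add: power2_eq_square divide_simps)
  finally show ?thesis by (simp add: mu_eq[abs_def])
qed

lemma mu_strict_antimono:
  assumes "0 < r" "r < t" "t < 1"
  shows "mu a t < mu a r"
proof (rule DERIV_neg_imp_decreasing[OF assms(2)])
  fix x assume "r \<le> x" "x \<le> t"
  then have x: "x \<in> {0<..<1}" using assms by auto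
  show "\<exists>d. (mu a has_real_derivative d) (at x) \<and> d < 0"
    using mu_deriv[OF x] square_bounds[OF x] F_square_pos[OF x] x
    by (intro exI[of _ "- inverse (x * (1 - x\<^sup>2) * (F (x\<^sup>2))\<^sup>2)"]) auto
qed

lemma mu_pos: "r \<in> {0<..<1} \<Longrightarrow> 0 < mu a r"
  using F_square_pos[of r] sin_pos by (simp add: mu_eq)

lemma F_square_tendsto_1: "((\<lambda>r. F (r\<^sup>2)) \<longlongrightarrow> 1) (at_right 0)"
proof -
  have "((\<lambda>r::real. r\<^sup>2) \<longlongrightarrow> 0\<^sup>2) (at_right 0)" by (intro tendsto_intros)
  then have "((\<lambda>r. F (r\<^sup>2)) \<longlongrightarrow> F 0) (at_right 0)"
    by (intro isCont_tendsto_compose[of 0 F] DERIV_isCont[OF F_deriv]) auto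
  then show ?thesis by simp
qed

lemma mu_at_top: "filterlim (mu a) at_top (at_right 0)"
proof -
  have ev: "\<forall>\<^sub>F r in at_right 0. 1 - r\<^sup>2 \<in> {..<1} \<and> 1 - r\<^sup>2 \<noteq> (1::real)"
    unfolding eventually_at_right_field by (intro exI[of _ 1]) auto
  have "((\<lambda>r::real. 1 - r\<^sup>2) \<longlongrightarrow> 1 - 0\<^sup>2) (at_right 0)" by (intro tendsto_intros)
  with ev have "filterlim (\<lambda>r::real. 1 - r\<^sup>2) (at_left 1) (at_right 0)"
    by (simp add: filterlim_at)
  then have "filterlim (\<lambda>r. F (1 - r\<^sup>2)) at_top (at_right 0)"
    by (rule filterlim_compose[OF F_at_top])
  moreover have "((\<lambda>r. pi / (2 * sin (pi * a)) / F (r\<^sup>2)) \<longlongrightarrow> pi / (2 * sin (pi * a)) / 1) (at_right 0)"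
    by (intro tendsto_intros F_square_tendsto_1) auto
  moreover have "0 < pi / (2 * sin (pi * a)) / 1" using sin_pos by simp
  ultimately have "filterlim (\<lambda>r. pi / (2 * sin (pi * a)) / F (r\<^sup>2) * F (1 - r\<^sup>2)) at_top (at_right 0)"
    by (intro filterlim_tendsto_pos_mult_at_top)
  then show ?thesis by (simp add: mu_eq[abs_def])
qed

lemma mu_tendsto_0: "(mu a \<longlongrightarrow> 0) (at_left 1)"
proof -
  have ev: "\<forall>\<^sub>F r in at_left 1. r\<^sup>2 \<in> {..<1} \<and> r\<^sup>2 \<noteq> (1::real)"
    unfolding eventually_at_left_field using square_bounds by (intro exI[of _ 0]) fastforce
  have "((\<lambda>r::real. r\<^sup>2) \<longlongrightarrow> 1\<^sup>2) (at_left 1)" by (intro tendsto_intros)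
  with ev have "filterlim (\<lambda>r::real. r\<^sup>2) (at_left 1) (at_left 1)"
    by (simp add: filterlim_at)
  then have top: "filterlim (\<lambda>r. F (r\<^sup>2)) at_top (at_left 1)"
    by (rule filterlim_compose[OF F_at_top])
  have "((\<lambda>r::real. 1 - r\<^sup>2) \<longlongrightarrow> 1 - 1\<^sup>2) (at_left 1)" by (intro tendsto_intros)
  then have "((\<lambda>r. F (1 - r\<^sup>2)) \<longlongrightarrow> F 0) (at_left 1)"
    by (intro isCont_tendsto_compose[of 0 F] DERIV_isCont[OF F_deriv]) auto
  then have "((\<lambda>r. F (1 - r\<^sup>2) / F (r\<^sup>2)) \<longlongrightarrow> 0) (at_left 1)"
    by (rule real_tendsto_divide_at_top[OF _ top])
  then have "((\<lambda>r. pi / (2 * sin (pi * a)) * (F (1 - r\<^sup>2) / F (r\<^sup>2))) \<longlongrightarrow>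
      pi / (2 * sin (pi * a)) * 0) (at_left 1)"
    by (rule tendsto_mult_left)
  then show ?thesis by (simp add: mu_eq[abs_def])
qed

lemma mu_bij: "bij_betw (mu a) {0<..<1} {0<..}"
proof (rule bij_betw_imageI)
  show "inj_on (mu a) {0<..<1}"
    using mu_strict_antimono by (intro linorder_inj_onI) fastforce+
  show "mu a ` {0<..<1} = {0<..}"
  proof (intro equalityI subsetI)
    fix u :: real assume "u \<in> {0<..}"
    then have u: "0 < u" by simp
    have "\<forall>\<^sub>F r in at_right 0. u < mu a r \<and> r \<in> {0<..<1}"
      using filterlim_at_top_dense[THEN iffD1, OF mu_at_top]
      by (intro eventually_conj eventually_at_right_real) auto
    then obtain r where r: "u < mu a r" "r \<in> {0<..<1}"
      using eventually_happens[of _ "at_right (0::real)"] by auto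
    have "\<forall>\<^sub>F t in at_left 1. mu a t < u \<and> t \<in> {0<..<1}"
      using order_tendstoD(2)[OF mu_tendsto_0 u]
      by (intro eventually_conj eventually_at_left_real) auto
    then obtain t where t: "mu a t < u" "t \<in> {0<..<1}"
      using eventually_happens[of _ "at_left (1::real)"] by auto
    have "r < t"
      using mu_strict_antimono[of t r] r t by (cases r t rule: linorder_cases) auto
    moreover have "isCont (mu a) x" if "r \<le> x" "x \<le> t" for x
      using that r t by (intro DERIV_isCont[OF mu_deriv]) auto
    ultimately have "\<exists>x\<ge>r. x \<le> t \<and> mu a x = u"
      using r t by (intro IVT2) auto
    then show "u \<in> mu a ` {0<..<1}" using r t by force
  qed (auto simp: mu_pos)
qed

lemma mu_inv_mu: "r \<in> {0<..<1} \<Longrightarrow> mu_inv a (mu a r) = r"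
  unfolding mu_inv_def by (rule the_inv_into_f_f[OF bij_betw_imp_inj_on[OF mu_bij]])

lemma mu_mu_inv: "0 < u \<Longrightarrow> mu a (mu_inv a u) = u"
  unfolding mu_inv_def by (rule f_the_inv_into_f_bij_betw[OF mu_bij]) simp

lemma mu_inv_in: "0 < u \<Longrightarrow> mu_inv a u \<in> {0<..<1}"
  using bij_betwE[OF bij_betw_the_inv_into[OF mu_bij]] by (simp add: mu_inv_def)

lemma mu_inv_less_iff:
  assumes "0 < u" "r \<in> {0<..<1}"
  shows "mu_inv a u < r \<longleftrightarrow> mu a r < u"
  using mu_strict_antimono[of "mu_inv a u" r] mu_strict_antimono[of r "mu_inv a u"]
    mu_inv_in[OF assms(1)] mu_mu_inv[OF assms(1)] assms(2)
  by (cases r "mu_inv a u" rule: linorder_cases) auto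

lemma mu_inv_deriv:
  assumes "0 < u"
  defines "r \<equiv> mu_inv a u"
  shows "(mu_inv a has_real_derivative - (r * (1 - r\<^sup>2) * (F (r\<^sup>2))\<^sup>2)) (at u)"
proof -
  have r: "r \<in> {0<..<1}" unfolding r_def by (rule mu_inv_in[OF assms(1)])
  have "isCont (mu_inv a) (mu a r)"
  proof (rule isCont_inverse_function2[where f = "mu a" and a = "r / 2" and b = "(r + 1) / 2"])
    fix z assume "r / 2 \<le> z" "z \<le> (r + 1) / 2"
    then have z: "z \<in> {0<..<1}" using r by auto
    show "mu_inv a (mu a z) = z" using z by (rule mu_inv_mu)
    show "isCont (mu a) z" by (rule DERIV_isCont[OF mu_deriv[OF z]])
  qed (use r in auto)
  then have "isCont (mu_inv a) u" using assms by (simp add: mu_mu_inv)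
  then have "(mu_inv a has_real_derivative inverse (- inverse (r * (1 - r\<^sup>2) * (F (r\<^sup>2))\<^sup>2))) (at u)"
    using mu_deriv[OF r] square_bounds[OF r] F_square_pos[OF r] r assms(1)
    by (intro DERIV_inverse_function[where a = 0 and b = "u + 1" and f = "mu a"])
       (auto simp: mu_mu_inv r_def)
  then show ?thesis by simp
qed

section \<open>The elasticity of the profile and the sharp distortion bounds\<close>

definition y :: "real \<Rightarrow> real" where
  "y u = - ln (mu_inv a u)"

definition G :: "real \<Rightarrow> real" where
  "G u = (1 - (mu_inv a u)\<^sup>2) * (F ((mu_inv a u)\<^sup>2))\<^sup>2"

text \<open>
  The elasticity \<open>u G'(u) / G(u)\<close> in closed form: differentiating \<open>G\<close> gives
  \<open>G' / G = 2 r\<^sup>2 F(r\<^sup>2) H(r\<^sup>2)\<close> with \<open>r = mu_inv a u\<close>, and the factor \<open>u = mu a r\<close> turns \<open>F(r\<^sup>2)\<close>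
  into \<open>F(1 - r\<^sup>2)\<close>.
\<close>

definition E :: "real \<Rightarrow> real" where
  "E u = pi / sin (pi * a) * ((mu_inv a u)\<^sup>2 * F (1 - (mu_inv a u)\<^sup>2)) * H ((mu_inv a u)\<^sup>2)"

lemma y_deriv:
  assumes "0 < u"
  shows "(y has_real_derivative G u) (at u)"
proof -
  let ?r = "mu_inv a u"
  have r: "?r \<in> {0<..<1}" by (rule mu_inv_in[OF assms])
  have "((\<lambda>u. - ln (mu_inv a u)) has_real_derivative
      - (- (?r * (1 - ?r\<^sup>2) * (F (?r\<^sup>2))\<^sup>2) / ?r)) (at u)"
    using r by (auto intro!: derivative_eq_intros mu_inv_deriv assms)
  then show ?thesis using r by (simp add: y_def[abs_def] G_def)
qed

lemma G_deriv:
  assumes "0 < u"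
  shows "(G has_real_derivative E u * G u / u) (at u)"
proof -
  define r where "r = mu_inv a u"
  define h where "h r = (1 - r\<^sup>2) * (F (r\<^sup>2))\<^sup>2" for r
  have r: "r \<in> {0<..<1}" unfolding r_def by (rule mu_inv_in[OF assms])
  note pos = F_square_pos[OF r]
  have "(h has_real_derivative - 2 * r * F (r\<^sup>2) * H (r\<^sup>2)) (at r)"
    unfolding h_def H_def
    by (rule derivative_eq_intros F_square_deriv(1)[OF r] refl)+
       (simp add: algebra_simps power2_eq_square)
  then have "((\<lambda>u. h (mu_inv a u)) has_real_derivative
      - 2 * r * F (r\<^sup>2) * H (r\<^sup>2) * (- (r * (1 - r\<^sup>2) * (F (r\<^sup>2))\<^sup>2))) (at u)"
    unfolding r_def by (rule DERIV_chain2[where f = h, OF _ mu_inv_deriv[OF assms]])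
  moreover have "- 2 * r * F (r\<^sup>2) * H (r\<^sup>2) * (- (r * (1 - r\<^sup>2) * (F (r\<^sup>2))\<^sup>2)) = E u * G u / u"
  proof -
    have u: "u = pi / (2 * sin (pi * a)) * (F (1 - r\<^sup>2) / F (r\<^sup>2))"
      using mu_mu_inv[OF assms] by (simp add: mu_eq r_def)
    have "E u = pi / sin (pi * a) * (r\<^sup>2 * F (1 - r\<^sup>2)) * H (r\<^sup>2)"
      by (simp add: E_def r_def)
    also have "\<dots> = pi / (2 * sin (pi * a)) * (F (1 - r\<^sup>2) / F (r\<^sup>2)) * (2 * r\<^sup>2 * F (r\<^sup>2) * H (r\<^sup>2))"
      using pos sin_pos by (simp add: field_simps)
    also have "\<dots> = u * (2 * r\<^sup>2 * F (r\<^sup>2) * H (r\<^sup>2))" by (simp only: u[symmetric])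
    finally have "E u * G u / u = 2 * r\<^sup>2 * F (r\<^sup>2) * H (r\<^sup>2) * G u" using assms by simp
    then show ?thesis by (simp add: G_def r_def[symmetric] power2_eq_square mult_ac)
  qed
  ultimately show ?thesis by (simp add: G_def[abs_def] h_def)
qed

lemma mu_inv_strict_antimono:
  assumes "0 < u" "u < v"
  shows "mu_inv a v < mu_inv a u"
  using assms mu_inv_less_iff[of v "mu_inv a u"] mu_inv_in[of u] by (simp add: mu_mu_inv)

lemma mu_inv_tendsto_0: "(mu_inv a \<longlongrightarrow> 0) at_top"
proof (rule order_tendstoI)
  fix e :: real assume "0 < e"
  define d where "d = min e (1 / 2)"
  have d: "d \<in> {0<..<1}" "d \<le> e" using \<open>0 < e\<close> by (auto simp: d_def)
  show "\<forall>\<^sub>F u in at_top. mu_inv a u < e"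
    using eventually_gt_at_top[of "mu a d"]
  proof eventually_elim
    case (elim u)
    then have "mu_inv a u < d" using mu_pos[OF d(1)] d by (subst mu_inv_less_iff) auto
    then show ?case using d by simp
  qed
next
  fix e :: real assume "e < 0"
  show "\<forall>\<^sub>F u in at_top. e < mu_inv a u"
    using eventually_gt_at_top[of 0] by eventually_elim (use mu_inv_in \<open>e < 0\<close> in force)
qed

lemma mu_inv_tendsto_1: "(mu_inv a \<longlongrightarrow> 1) (at_right 0)"
proof (rule order_tendstoI)
  fix e :: real assume "e < 1"
  define d where "d = max e (1 / 2)"
  have d: "d \<in> {0<..<1}" "e \<le> d" using \<open>e < 1\<close> by (auto simp: d_def)
  have "\<forall>\<^sub>F u in at_right 0. u \<in> {0<..<mu a d}"
    using mu_pos[OF d(1)] by (rule eventually_at_right_real)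
  then show "\<forall>\<^sub>F u in at_right 0. e < mu_inv a u"
  proof eventually_elim
    case (elim u)
    then have "d < mu_inv a u"
      using mu_inv_strict_antimono[of u "mu a d"] mu_inv_mu[OF d(1)] by simp
    then show ?case using d by simp
  qed
next
  fix e :: real assume "1 < e"
  show "\<forall>\<^sub>F u in at_right 0. mu_inv a u < e"
    using eventually_at_right_less[of "0::real"] by eventually_elim (use mu_inv_in \<open>1 < e\<close> in force)
qed

sublocale decreasing_elasticity y G E
proof
  fix u :: real assume u: "0 < u"
  let ?r = "mu_inv a u"
  have r: "?r \<in> {0<..<1}" by (rule mu_inv_in[OF u])
  note b = square_bounds[OF r] and pos = F_square_pos[OF r]
  show "(y has_real_derivative G u) (at u)" by (rule y_deriv[OF u])
  show "(G has_real_derivative E u * G u / u) (at u)" by (rule G_deriv[OF u])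
  show "0 < G u" using b pos by (simp add: G_def)
  show "0 < E u" using b pos r sin_pos H_pos[of "?r\<^sup>2"] by (simp add: E_def)
next
  fix u v :: real assume u: "0 < u" and uv: "u < v"
  let ?r = "mu_inv a u" and ?t = "mu_inv a v"
  have r: "?r \<in> {0<..<1}" and t: "?t \<in> {0<..<1}" using u uv mu_inv_in[of u] mu_inv_in[of v] by auto
  have sq: "?t\<^sup>2 < ?r\<^sup>2"
    using mu_inv_strict_antimono[OF u uv] t by (intro power_strict_mono) auto
  note br = square_bounds[OF r] and bt = square_bounds[OF t]
  have less: "?t\<^sup>2 * F (1 - ?t\<^sup>2) < ?r\<^sup>2 * F (1 - ?r\<^sup>2)"
    using one_minus_mult_F_strict_antimono[of "1 - ?r\<^sup>2" "1 - ?t\<^sup>2"] sq br bt by simp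
  have H: "H (?t\<^sup>2) \<le> H (?r\<^sup>2)" "0 < H (?t\<^sup>2)"
    using sq br bt by (auto intro: H_mono H_pos)
  have "0 \<le> ?t\<^sup>2 * F (1 - ?t\<^sup>2)"
    using F_square_pos[OF t] by simp
  from mult_less_le_imp_less[OF less H(1) this H(2)]
  have "?t\<^sup>2 * F (1 - ?t\<^sup>2) * H (?t\<^sup>2) < ?r\<^sup>2 * F (1 - ?r\<^sup>2) * H (?r\<^sup>2)" .
  then show "E v < E u"
    unfolding E_def mult.assoc using sin_pos by (intro mult_strict_left_mono) (auto simp: mult.assoc)
next
  have "((\<lambda>u. - ln (mu_inv a u)) \<longlongrightarrow> - ln 1) (at_right 0)"
    by (intro tendsto_intros mu_inv_tendsto_1) auto
  then show "(y \<longlongrightarrow> 0) (at_right 0)" by (simp add: y_def[abs_def])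
next
  have "((\<lambda>u. (mu_inv a u)\<^sup>2) \<longlongrightarrow> 0\<^sup>2) at_top" by (intro tendsto_intros mu_inv_tendsto_0)
  then have "((\<lambda>u. F ((mu_inv a u)\<^sup>2)) \<longlongrightarrow> F 0) at_top"
    by (intro isCont_tendsto_compose[of 0 F] DERIV_isCont[OF F_deriv]) auto
  then have "((\<lambda>u. (1 - (mu_inv a u)\<^sup>2) * (F ((mu_inv a u)\<^sup>2))\<^sup>2) \<longlongrightarrow> (1 - 0\<^sup>2) * (F 0)\<^sup>2) at_top"
    by (intro tendsto_intros mu_inv_tendsto_0)
  then show "(G \<longlongrightarrow> 1) at_top" by (simp add: G_def[abs_def])
qed

lemma huebner_m_eq:
  assumes "r \<in> {0<..<1}"
  shows "huebner_m a r = mu a r * G (mu a r)"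
proof -
  have "(sqrt (1 - r\<^sup>2))\<^sup>2 = 1 - r\<^sup>2" using square_bounds[OF assms] by simp
  then have "huebner_m a r = pi / (2 * sin (pi * a)) * (1 - r\<^sup>2) * F (r\<^sup>2) * F (1 - r\<^sup>2)"
    using sin_pos by (simp add: huebner_m_def ell_K_def hyp2F1_eq_F field_simps power2_eq_square)
  also have "\<dots> = mu a r * ((1 - r\<^sup>2) * (F (r\<^sup>2))\<^sup>2)"
    using F_square_pos[OF assms] sin_pos by (simp add: mu_eq power2_eq_square)
  also have "(1 - r\<^sup>2) * (F (r\<^sup>2))\<^sup>2 = G (mu a r)"
    by (simp add: G_def mu_inv_mu[OF assms])
  finally show ?thesis .
qed

lemma distortion_bounds:
  assumes r: "r \<in> {0<..<1}" and t: "t \<in> {0<..<1}"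
  defines "Q \<equiv> \<lambda>k. mu_inv a (mu a r * k) * mu_inv a (mu a t * k) / mu_inv a (mu a (r * t) * k)"
    and "M \<equiv> huebner_m a r + huebner_m a t - huebner_m a (r * t)"
  shows "(\<forall>k\<in>{0<..<1}. Q k < exp (c * (1 - k))) \<longleftrightarrow> M \<le> c"
    and "(\<forall>k\<in>{1<..}. Q k < exp (c * (1 - k))) \<longleftrightarrow> c \<le> M"
    and "(\<forall>k\<in>{1<..}. exp (c * (1 - k)) < Q k) \<longleftrightarrow> mu a r + mu a t - mu a (r * t) \<le> c"
proof -
  have lt: "r * t < r" "r * t < t" using r t by auto
  have rt: "r * t \<in> {0<..<1}" using r t order.strict_trans[OF lt(1), of 1] by simp
  interpret balanced_triple y G E "mu a r" "mu a t" "mu a (r * t)"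
  proof
    show "0 < mu a r" "0 < mu a t" using r t by (auto intro: mu_pos)
    show "mu a r < mu a (r * t)" "mu a t < mu a (r * t)"
      using r t rt lt by (auto intro!: mu_strict_antimono)
    show "y (mu a r) + y (mu a t) = y (mu a (r * t))"
      using r t rt by (simp add: y_def mu_inv_mu ln_mult)
  qed
  have Q: "Q k = exp (- defect k)" if "0 < k" for k
  proof -
    have "0 < mu_inv a (mu a x * k)" if "x \<in> {0<..<1}" for x
      using mu_inv_in[of "mu a x * k"] mu_pos[OF that] \<open>0 < k\<close> by simp
    from this[OF r] this[OF t] this[OF rt] show ?thesis
      by (simp add: Q_def defect_def y_def exp_add exp_diff mult.commute[of k])
  qed
  have M: "M = slope 1"
    using r t rt by (simp add: M_def slope_def huebner_m_eq)
  show "(\<forall>k\<in>{0<..<1}. Q k < exp (c * (1 - k))) \<longleftrightarrow> M \<le> c"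
    unfolding M defect_bound_below_iff[symmetric] by (auto simp: Q)
  show "(\<forall>k\<in>{1<..}. Q k < exp (c * (1 - k))) \<longleftrightarrow> c \<le> M"
    unfolding M defect_bound_above_iff[symmetric] by (auto simp: Q)
  show "(\<forall>k\<in>{1<..}. exp (c * (1 - k)) < Q k) \<longleftrightarrow> mu a r + mu a t - mu a (r * t) \<le> c"
    unfolding defect_lower_bound_iff[symmetric] by (auto simp: Q)
qed

text \<open>
  The exponents of the two parts become the same expression \<open>c (1 - k)\<close> under \<open>k = 1 / K\<close> and
  \<open>k = K\<close>, with \<open>k\<close> below and above 1 respectively.
\<close>

lemma phi_bounds:
  assumes r: "r \<in> {0<..<1}" and t: "t \<in> {0<..<1}"
  defines "M \<equiv> huebner_m a r + huebner_m a t - huebner_m a (r * t)"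
  shows "(\<forall>K\<in>{1<..}. phi a K r * phi a K t / phi a K (r * t) < exp (c * (1 - 1 / K))) \<longleftrightarrow> M \<le> c"
    and "(\<forall>K\<in>{1<..}. phi a (1 / K) r * phi a (1 / K) t / phi a (1 / K) (r * t) < exp (c * (1 - K)))
      \<longleftrightarrow> c \<le> M"
    and "(\<forall>K\<in>{1<..}. exp (c * (1 - K)) < phi a (1 / K) r * phi a (1 / K) t / phi a (1 / K) (r * t))
      \<longleftrightarrow> mu a r + mu a t - mu a (r * t) \<le> c"
proof -
  have inv: "(\<forall>K\<in>{1<..}. P (1 / K)) \<longleftrightarrow> (\<forall>k\<in>{0<..<1}. P k)" for P :: "real \<Rightarrow> bool"
  proof
    assume *: "\<forall>K\<in>{1<..}. P (1 / K)"
    show "\<forall>k\<in>{0<..<1}. P k"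
    proof
      fix k :: real assume "k \<in> {0<..<1}"
      then show "P k" using *[rule_format, of "1 / k"] by simp
    qed
  qed auto
  show "(\<forall>K\<in>{1<..}. phi a K r * phi a K t / phi a K (r * t) < exp (c * (1 - 1 / K))) \<longleftrightarrow> M \<le> c"
    unfolding M_def distortion_bounds(1)[OF r t, symmetric] inv[symmetric] by (simp add: phi_def)
  show "(\<forall>K\<in>{1<..}. phi a (1 / K) r * phi a (1 / K) t / phi a (1 / K) (r * t) < exp (c * (1 - K)))
      \<longleftrightarrow> c \<le> M"
    unfolding M_def distortion_bounds(2)[OF r t, symmetric] by (simp add: phi_def)
  show "(\<forall>K\<in>{1<..}. exp (c * (1 - K)) < phi a (1 / K) r * phi a (1 / K) t / phi a (1 / K) (r * t))
      \<longleftrightarrow> mu a r + mu a t - mu a (r * t) \<le> c"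
    unfolding distortion_bounds(3)[OF r t, symmetric] by (simp add: phi_def)
qed

end

theorem theorem3p1:
  fixes \<alpha> \<beta> \<gamma> :: "real \<Rightarrow> real \<Rightarrow> real \<Rightarrow> real"
  shows
    "((\<forall>a\<in>{0<..1/2}. \<forall>r\<in>{0<..<1}. \<forall>t\<in>{0<..<1}. \<forall>K\<in>{1<..}.
        phi a K r * phi a K t / phi a K (r * t) < exp (\<alpha> a r t * (1 - 1 / K)))
     \<longleftrightarrow>
     (\<forall>a\<in>{0<..1/2}. \<forall>r\<in>{0<..<1}. \<forall>t\<in>{0<..<1}.
        \<alpha> a r t \<ge> huebner_m a r + huebner_m a t - huebner_m a (r * t)))
     \<and>
     ((\<forall>a\<in>{0<..1/2}. \<forall>r\<in>{0<..<1}. \<forall>t\<in>{0<..<1}. \<forall>K\<in>{1<..}.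
        exp (\<gamma> a r t * (1 - K)) < phi a (1 / K) r * phi a (1 / K) t / phi a (1 / K) (r * t) \<and>
        phi a (1 / K) r * phi a (1 / K) t / phi a (1 / K) (r * t) < exp (\<beta> a r t * (1 - K)))
     \<longleftrightarrow>
     (\<forall>a\<in>{0<..1/2}. \<forall>r\<in>{0<..<1}. \<forall>t\<in>{0<..<1}.
        \<beta> a r t \<le> huebner_m a r + huebner_m a t - huebner_m a (r * t) \<and>
        \<gamma> a r t \<ge> mu a r + mu a t - mu a (r * t)))"
    (is "?upper \<and> ?two_sided")
proof -
  have param: "hypergeometric_parameter a" if "a \<in> {0<..1 / 2}" for a
    using that by unfold_locales auto
  note bounds = hypergeometric_parameter.phi_bounds[OF param]
  show ?thesis
  proof (intro conjI)
    show ?upper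
      by (intro ball_cong refl bounds(1))
    have "(\<forall>K\<in>{1<..}. exp (\<gamma> a r t * (1 - K)) < phi a (1 / K) r * phi a (1 / K) t / phi a (1 / K) (r * t) \<and>
        phi a (1 / K) r * phi a (1 / K) t / phi a (1 / K) (r * t) < exp (\<beta> a r t * (1 - K))) \<longleftrightarrow>
        \<beta> a r t \<le> huebner_m a r + huebner_m a t - huebner_m a (r * t) \<and>
        mu a r + mu a t - mu a (r * t) \<le> \<gamma> a r t"
      if "a \<in> {0<..1 / 2}" "r \<in> {0<..<1}" "t \<in> {0<..<1}" for a r t
      unfolding bounds(2)[OF that, symmetric] bounds(3)[OF that, symmetric] by blast
    then show ?two_sided
      by (intro ball_cong refl)
  qed
qed

end
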